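(* Let $A$ be a non-trivial event ($A\neq\emptyset,\Omega$) and $\mathcal B$ a partition of $\Omega$ into non-empty events. Let $\underline P$ be a coherent conditional lower probability, with conjugate $\overline P$, whose domain contains $A$, $A^{\mathsf c}$ and $A|B$, $A^{\mathsf c}|B$ for all $B\in\mathcal B$. If $A$ is either logically dependent on $\mathcal B$, or semidependent on $\mathcal B$ with a semidependence that is not one-sided, then $\mathcal B$ does not dilate $A$ weakly and non-trivially.
   Context: Events are subsets of a set $\Omega$ (the sure event); $B\Rightarrow A$ means $B\subseteq A$, and an unconditional event $A$ is identified with $A|\Omega$. A (de Finetti) coherent conditional probability on a set $\mathcal D$ of conditional events is the restriction to $\mathcal D$ of a full conditional probability on an algebra of events containing all events involved: a map $P(\cdot|\cdot)$ such that for each non-empty $B$, $P(\cdot|B)$ is a finitely additive probability with $P(B|B)=1$, and $P(A\wedge C|B)=P(A|C\wedge B)\,P(C|B)$ whenever $C\wedge B\ne\emptyset$. A lower probability $\underline P$ on $\mathcal D$ is coherent (Williams-coherent) if it is the pointwise infimum of a non-empty set of coherent conditional probabilities on $\mathcal D$; its conjugate is $\overline P(A|B)=1-\underline P(A^{\mathsf c}|B)$. $\mathcal B$ weakly dilates $A$ (with respect to $\underline P,\overline P$) if $\underline P(A|B)\le\underline P(A)\le\overline P(A)\le\overline P(A|B)$ for all $B\in\mathcal B$; weak dilation is trivial if all three inequalities are equalities for every $B\in\mathcal B$, and non-trivial otherwise. $A$ is logically dependent on $\mathcal B$ if for every $B\in\mathcal B$ either $B\Rightarrow A$ or $B\Rightarrow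 A^{\mathsf c}$. $A$ is (logically) semidependent on $\mathcal B$ if there is $B'\in\mathcal B$ with $B'\not\Rightarrow A$ and $B'\not\Rightarrow A^{\mathsf c}$, and there is $B''\in\mathcal B$ with either $B''\Rightarrow A$ or $B''\Rightarrow A^{\mathsf c}$. The semidependence is one-sided of type 1 if no $B\in\mathcal B$ satisfies $B\Rightarrow A$, one-sided of type 2 if no $B\in\mathcal B$ satisfies $B\Rightarrow A^{\mathsf c}$, and one-sided if it is of type 1 or type 2. *)

theory Defs
  imports "HOL-Analysis.Measure_Space"
begin

text \<open>
  Events are subsets of a sure event \<open>\<Omega>\<close>. A conditional event \<open>E|H\<close> is the pair \<open>(E, H)\<close>; the
  unconditional event \<open>E\<close> is \<open>(E, \<Omega>)\<close>. A conditional (lower) probability is a curried function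
  \<open>P\<close> whose value at \<open>E|H\<close> is \<open>P E H\<close>; its domain is a separate set \<open>\<D>\<close> of pairs, and values of
  \<open>P\<close> outside \<open>\<D>\<close> carry no meaning.
\<close>

definition finitely_additive_prob :: "'a set \<Rightarrow> 'a set set \<Rightarrow> ('a set \<Rightarrow> real) \<Rightarrow> bool" where
  "finitely_additive_prob \<Omega> \<A> p \<longleftrightarrow>
     (\<forall>E\<in>\<A>. 0 \<le> p E) \<and> p \<Omega> = 1 \<and> additive \<A> p"

definition full_cond_prob :: "'a set \<Rightarrow> 'a set set \<Rightarrow> ('a set \<Rightarrow> 'a set \<Rightarrow> real) \<Rightarrow> bool" where
  "full_cond_prob \<Omega> \<A> P \<longleftrightarrow>
     algebra \<Omega> \<A> \<and>
     (\<forall>H\<in>\<A>. H \<noteq> {} \<longrightarrow> finitely_additive_prob \<Omega> \<A> (\<lambda>E. P E H) \<and> P H H = 1) \<and>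
     (\<forall>E\<in>\<A>. \<forall>F\<in>\<A>. \<forall>H\<in>\<A>. F \<inter> H \<noteq> {} \<longrightarrow> P (E \<inter> F) H = P E (F \<inter> H) * P F H)"

definition coherent_cond_prob ::
  "'a set \<Rightarrow> ('a set \<times> 'a set) set \<Rightarrow> ('a set \<Rightarrow> 'a set \<Rightarrow> real) \<Rightarrow> bool" where
  "coherent_cond_prob \<Omega> \<D> P \<longleftrightarrow>
     (\<exists>\<A> Q. full_cond_prob \<Omega> \<A> Q \<and> \<D> \<subseteq> \<A> \<times> (\<A> - {{}}) \<and>
        (\<forall>(E, H)\<in>\<D>. P E H = Q E H))"

text \<open>
  The real-valued infimum below is a genuine one: the values at \<open>E|H \<in> \<D>\<close> of a coherent
  conditional probability are bounded below by 0. The members of \<open>\<P>\<close> may come from full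
  conditional probabilities on different algebras.
\<close>

definition coherent_lower_prob ::
  "'a set \<Rightarrow> ('a set \<times> 'a set) set \<Rightarrow> ('a set \<Rightarrow> 'a set \<Rightarrow> real) \<Rightarrow> bool" where
  "coherent_lower_prob \<Omega> \<D> lP \<longleftrightarrow>
     (\<exists>\<P>. \<P> \<noteq> {} \<and> (\<forall>P\<in>\<P>. coherent_cond_prob \<Omega> \<D> P) \<and>
        (\<forall>(E, H)\<in>\<D>. lP E H = (INF P\<in>\<P>. P E H)))"

definition conjugate_prob ::
  "'a set \<Rightarrow> ('a set \<Rightarrow> 'a set \<Rightarrow> real) \<Rightarrow> 'a set \<Rightarrow> 'a set \<Rightarrow> real" where
  "conjugate_prob \<Omega> lP E H = 1 - lP (\<Omega> - E) H"

definition weakly_dilates ::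
  "'a set \<Rightarrow> ('a set \<Rightarrow> 'a set \<Rightarrow> real) \<Rightarrow> ('a set \<Rightarrow> 'a set \<Rightarrow> real) \<Rightarrow> 'a set set \<Rightarrow> 'a set \<Rightarrow> bool" where
  "weakly_dilates \<Omega> lP uP \<B> A \<longleftrightarrow>
     (\<forall>B\<in>\<B>. lP A B \<le> lP A \<Omega> \<and> lP A \<Omega> \<le> uP A \<Omega> \<and> uP A \<Omega> \<le> uP A B)"

definition trivially_weakly_dilates ::
  "'a set \<Rightarrow> ('a set \<Rightarrow> 'a set \<Rightarrow> real) \<Rightarrow> ('a set \<Rightarrow> 'a set \<Rightarrow> real) \<Rightarrow> 'a set set \<Rightarrow> 'a set \<Rightarrow> bool" where
  "trivially_weakly_dilates \<Omega> lP uP \<B> A \<longleftrightarrow>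
     weakly_dilates \<Omega> lP uP \<B> A \<and>
     (\<forall>B\<in>\<B>. lP A B = lP A \<Omega> \<and> lP A \<Omega> = uP A \<Omega> \<and> uP A \<Omega> = uP A B)"

definition nontrivially_weakly_dilates ::
  "'a set \<Rightarrow> ('a set \<Rightarrow> 'a set \<Rightarrow> real) \<Rightarrow> ('a set \<Rightarrow> 'a set \<Rightarrow> real) \<Rightarrow> 'a set set \<Rightarrow> 'a set \<Rightarrow> bool" where
  "nontrivially_weakly_dilates \<Omega> lP uP \<B> A \<longleftrightarrow>
     weakly_dilates \<Omega> lP uP \<B> A \<and> \<not> trivially_weakly_dilates \<Omega> lP uP \<B> A"

definition logically_dependent :: "'a set \<Rightarrow> 'a set set \<Rightarrow> 'a set \<Rightarrow> bool" where
  "logically_dependent \<Omega> \<B> A \<longleftrightarrow> (\<forall>B\<in>\<B>. B \<subseteq> A \<or> B \<subseteq> \<Omega> - A)"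

definition semidependent :: "'a set \<Rightarrow> 'a set set \<Rightarrow> 'a set \<Rightarrow> bool" where
  "semidependent \<Omega> \<B> A \<longleftrightarrow>
     (\<exists>B'\<in>\<B>. \<not> B' \<subseteq> A \<and> \<not> B' \<subseteq> \<Omega> - A) \<and> (\<exists>B''\<in>\<B>. B'' \<subseteq> A \<or> B'' \<subseteq> \<Omega> - A)"

definition one_sided_type1 :: "'a set \<Rightarrow> 'a set set \<Rightarrow> 'a set \<Rightarrow> bool" where
  "one_sided_type1 \<Omega> \<B> A \<longleftrightarrow> semidependent \<Omega> \<B> A \<and> \<not> (\<exists>B\<in>\<B>. B \<subseteq> A)"

definition one_sided_type2 :: "'a set \<Rightarrow> 'a set set \<Rightarrow> 'a set \<Rightarrow> bool" where
  "one_sided_type2 \<Omega> \<B> A \<longleftrightarrow> semidependent \<Omega> \<B> A \<and> \<not> (\<exists>B\<in>\<B>. B \<subseteq> \<Omega> - A)"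

definition one_sided_semidependent :: "'a set \<Rightarrow> 'a set set \<Rightarrow> 'a set \<Rightarrow> bool" where
  "one_sided_semidependent \<Omega> \<B> A \<longleftrightarrow> one_sided_type1 \<Omega> \<B> A \<or> one_sided_type2 \<Omega> \<B> A"

end

theory Submission
  imports Defs
begin

text \<open>
  A block inside \<open>A\<close> forces the lower probability of \<open>A\<close> given it to be 1, and a block
  inside the complement forces the upper probability of \<open>A\<close> given it to be 0. Under either
  hypothesis both kinds of block exist, so even weak dilation fails: it would give
  \<open>1 \<le> lP A \<Omega> \<le> uP A \<Omega> \<le> 0\<close>.
\<close>

text \<open>The product rule of the full conditional probability \<open>Q\<close> with conditioning
  factor \<open>H\<close> itself reads \<open>Q (E \<inter> H) H = Q E H * Q H H\<close>. Since
  \<open>E \<inter> H = H\<close> and \<open>Q H H = 1\<close>, the value \<open>Q E H\<close> is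
  1.\<close>

lemma coherent_cond_prob_eq_1:
  assumes "coherent_cond_prob \<Omega> \<D> P" and "(E, H) \<in> \<D>" and "H \<subseteq> E"
  shows "P E H = 1"
proof -
  obtain \<A> Q where Q: "full_cond_prob \<Omega> \<A> Q" and D: "\<D> \<subseteq> \<A> \<times> (\<A> - {{}})"
    and PQ: "\<forall>(E, H)\<in>\<D>. P E H = Q E H"
    using assms(1) unfolding coherent_cond_prob_def by blast
  have EH: "E \<in> \<A>" "H \<in> \<A>" "H \<noteq> {}" using D assms(2) by auto
  have "Q H H = 1" using Q EH unfolding full_cond_prob_def by blast
  moreover have "Q (E \<inter> H) H = Q E (H \<inter> H) * Q H H"
    using Q EH unfolding full_cond_prob_def by (metis Int_absorb)
  ultimately have "Q E H = 1" using assms(3) by (simp add: Int_absorb1)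
  then show ?thesis using PQ assms(2) by auto
qed

text \<open>All members of the family whose infimum is \<open>lP\<close> agree on the value 1 here.
  The family is non-empty, so the infimum of this constant is 1.\<close>

lemma coherent_lower_prob_eq_1:
  assumes "coherent_lower_prob \<Omega> \<D> lP" and "(E, H) \<in> \<D>" and "H \<subseteq> E"
  shows "lP E H = 1"
proof -
  obtain \<P> where "\<P> \<noteq> {}" and coh: "\<forall>P\<in>\<P>. coherent_cond_prob \<Omega> \<D> P"
    and lP: "lP E H = (INF P\<in>\<P>. P E H)"
    using assms(1,2) unfolding coherent_lower_prob_def by blast
  have "(\<lambda>P. P E H) ` \<P> = (\<lambda>P. 1) ` \<P>"
    by (rule image_cong[OF refl]) (use coherent_cond_prob_eq_1 coh assms(2,3) in blast)
  then show ?thesis using lP \<open>\<P> \<noteq> {}\<close> by simp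
qed

theorem proposition7p4:
  fixes \<Omega> A :: "'a set" and \<B> :: "'a set set"
    and \<D> :: "('a set \<times> 'a set) set"
    and lP :: "'a set \<Rightarrow> 'a set \<Rightarrow> real"
  assumes "A \<subseteq> \<Omega>" and "A \<noteq> {}" and "A \<noteq> \<Omega>"
    and "partition_on \<Omega> \<B>"
    and "coherent_lower_prob \<Omega> \<D> lP"
    and "(A, \<Omega>) \<in> \<D>" and "(\<Omega> - A, \<Omega>) \<in> \<D>"
    and "\<And>B. B \<in> \<B> \<Longrightarrow> (A, B) \<in> \<D>" and "\<And>B. B \<in> \<B> \<Longrightarrow> (\<Omega> - A, B) \<in> \<D>"
    and "logically_dependent \<Omega> \<B> A \<or>
         (semidependent \<Omega> \<B> A \<and> \<not> one_sided_semidependent \<Omega> \<B> A)"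
  shows "\<not> nontrivially_weakly_dilates \<Omega> lP (conjugate_prob \<Omega> lP) \<B> A"
proof
  assume "nontrivially_weakly_dilates \<Omega> lP (conjugate_prob \<Omega> lP) \<B> A"
  then have dil: "weakly_dilates \<Omega> lP (conjugate_prob \<Omega> lP) \<B> A"
    by (simp add: nontrivially_weakly_dilates_def)
  have un: "\<Union>\<B> = \<Omega>" using assms(4) by (simp add: partition_on_def)
  have "(\<exists>B\<in>\<B>. B \<subseteq> A) \<and> (\<exists>B\<in>\<B>. B \<subseteq> \<Omega> - A)"
    using assms(10)
  proof
    assume dep: "logically_dependent \<Omega> \<B> A"
    obtain x y where x: "x \<in> A" "x \<in> \<Omega>" and y: "y \<in> \<Omega> - A"
      using assms(1-3) by blast
    \<comment> \<open>The block around \<open>x\<close> meets \<open>A\<close>, so it cannot lie in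
      the complement and dependence puts it inside \<open>A\<close>; the block around
      \<open>y\<close> is symmetric.\<close>
    obtain Bx By where "Bx \<in> \<B>" "x \<in> Bx" and "By \<in> \<B>" "y \<in> By"
      using un x y by blast
    then show ?thesis
      using dep x y unfolding logically_dependent_def by blast
  next
    assume "semidependent \<Omega> \<B> A \<and> \<not> one_sided_semidependent \<Omega> \<B> A"
    \<comment> \<open>Given semidependence, failing type 1 means some block lies in
      \<open>A\<close>, and failing type 2 means some block lies in the complement.\<close>
    then show ?thesis
      by (auto simp: one_sided_semidependent_def one_sided_type1_def one_sided_type2_def)
  qed
  then obtain B1 B2 where B1: "B1 \<in> \<B>" "B1 \<subseteq> A" and B2: "B2 \<in> \<B>" "B2 \<subseteq> \<Omega> - A"
    by blast
  have "lP A B1 = 1"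
    using coherent_lower_prob_eq_1[OF assms(5)] assms(8) B1 by blast
  \<comment> \<open>Here \<open>E\<close> is \<open>\<Omega> - A\<close>: its lower probability
    given \<open>B2\<close> is 1, and conjugation turns this into 0.\<close>
  moreover have "conjugate_prob \<Omega> lP A B2 = 0"
    using coherent_lower_prob_eq_1[OF assms(5)] assms(9) B2
    by (simp add: conjugate_prob_def)
  \<comment> \<open>The lower bound is taken at \<open>B1\<close> and the upper bound at
    \<open>B2\<close>; the unconditional values link the two blocks.\<close>
  moreover have "lP A B1 \<le> lP A \<Omega>" "lP A \<Omega> \<le> conjugate_prob \<Omega> lP A \<Omega>"
    "conjugate_prob \<Omega> lP A \<Omega> \<le> conjugate_prob \<Omega> lP A B2"
    using dil B1 B2 by (auto simp: weakly_dilates_def)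
  ultimately show False by linarith
qed

end
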